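(* Let $L\in C^3(\mathbb{R}^d,\mathbb{R})$ and suppose there are constants $D_1,D_2,D_3,D_4$ with $\sup_{\theta}\|\nabla^jL(\theta)\|\le D_j$ for $j=1,2,3$ and $\|\nabla^3L(\theta_1)-\nabla^3L(\theta_2)\|\le D_4\|\theta_1-\theta_2\|$ for all $\theta_1,\theta_2\in\mathbb{R}^d$ (Euclidean operator norms). Then there exists $h_0>0$ such that for every $h\in(0,h_0)$ there are constants $\gamma,\delta,\lambda>0$ with the following properties: there exists a unique $g_h\in\Gamma_{\gamma,\delta,\lambda}$ satisfying, for all $\theta\in\mathbb{R}^d$, $$-\frac{1}{1-\beta}\nabla L(\zeta_h(\theta))+h\,g_h(\zeta_h(\theta))=-\frac{1}{1-\beta}\nabla L(\theta)+h\beta\,g_h(\theta),\qquad \zeta_h(\theta):=\theta-\frac{h}{1-\beta}\nabla L(\theta)+h^2\beta g_h(\theta),$$ and for every sequence $(\theta^{(n)},v^{(n)})$ generated by full-batch heavy-ball momentum (with arbitrary $\theta^{(0)},v^{(0)}\in\mathbb{R}^d$), $$\Big\|v^{(n)}+\tfrac{1}{1-\beta}\nabla L(\theta^{(n)})-h g_h(\theta^{(n)})\Big\|\le(\beta+h^2\beta\delta)^n\Big\|v^{(0)}+\tfrac{1}{1-\beta}\nabla L(\theta^{(0)})-h g_h(\theta^{(0)})\Big\|\quad\text{for all }n\ge0.$$ In particular $g_h$ is $C^1$ with symmetric Jacobian.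
   Context: Fix $\beta\in(0,1)$ and step size $h>0$. Full-batch heavy-ball momentum (HB) with loss $L:\mathbb{R}^d\to\mathbb{R}$ is the iteration $\theta^{(n+1)}=\theta^{(n)}-h\nabla L(\theta^{(n)})+h\beta v^{(n)}$, $v^{(n+1)}=\beta v^{(n)}-\nabla L(\theta^{(n)})$, $n\ge0$. For constants $\gamma,\delta,\lambda>0$, $\Gamma_{\gamma,\delta,\lambda}$ is the set of $g\in C^1(\mathbb{R}^d,\mathbb{R}^d)$ such that $\sup_\theta\|g(\theta)\|\le\gamma$, $\sup_\theta\|\nabla g(\theta)\|\le\delta$, and the Jacobian $\nabla g$ is symmetric at every point and $\lambda$-Lipschitz (in Euclidean operator norm). *)

theory Defs
  imports "HOL-Analysis.Analysis"
begin

definition Gamma :: "real \<Rightarrow> real \<Rightarrow> real \<Rightarrow> (real^'n \<Rightarrow> real^'n) set" where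
  "Gamma \<gamma> \<delta> lam = {g. \<exists>Dg :: real^'n \<Rightarrow> ((real^'n) \<Rightarrow>\<^sub>L (real^'n)).
      (\<forall>\<theta>. (g has_derivative blinfun_apply (Dg \<theta>)) (at \<theta>)) \<and>
      continuous_on UNIV Dg \<and>
      (\<forall>\<theta>. norm (g \<theta>) \<le> \<gamma>) \<and>
      (\<forall>\<theta>. norm (Dg \<theta>) \<le> \<delta>) \<and>
      (\<forall>\<theta>. transpose (matrix (blinfun_apply (Dg \<theta>))) = matrix (blinfun_apply (Dg \<theta>))) \<and>
      (\<forall>\<theta>1 \<theta>2. norm (Dg \<theta>1 - Dg \<theta>2) \<le> lam * dist \<theta>1 \<theta>2)}"

definition HB_seq :: "real \<Rightarrow> real \<Rightarrow> (real^'n \<Rightarrow> real^'n) \<Rightarrow> (nat \<Rightarrow> real^'n) \<Rightarrow> (nat \<Rightarrow> real^'n) \<Rightarrow> bool" where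
  "HB_seq \<beta> h G \<theta>s vs \<longleftrightarrow> (\<forall>n.
      \<theta>s (Suc n) = \<theta>s n - h *\<^sub>R G (\<theta>s n) + (h * \<beta>) *\<^sub>R vs n \<and>
      vs (Suc n) = \<beta> *\<^sub>R vs n - G (\<theta>s n))"

end

theory Submission
  imports Defs
begin

text \<open>
  Put \<open>w = - G / (1 - \<beta>) + h g\<close>. The equation for \<open>g\<close> says that the graph \<open>v = w(\<theta>)\<close> is invariant
  under the heavy-ball map. As one step of the map satisfies \<open>\<theta>' = \<theta> + h v'\<close>, the predecessor of a
  point \<open>x\<close> on the graph is \<open>x - h w(x)\<close>, so invariance amounts to the fixed point equation
  \<open>w(x) = (\<beta> w - G)(x - h w(x))\<close>, in which no map has to be inverted. For small \<open>h\<close> the right-hand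
  side preserves suitable bounds on \<open>w\<close>, on its derivative and on the Lipschitz constant of the
  derivative, and Picard iterates converge geometrically together with their derivatives. The
  Jacobian of the iterates is not symmetric; symmetry holds only for the limit and comes from the
  conformally symplectic nature of the map. Attraction is a one-step Lipschitz estimate.
\<close>

section \<open>Lipschitz bounds and perturbations of the identity\<close>

lemma lipschitz_of_blinfun_derivative_bound:
  fixes f :: "'a::real_normed_vector \<Rightarrow> 'b::real_normed_vector"
  assumes "\<And>x. (f has_derivative blinfun_apply (f' x)) (at x)"
    and "\<And>x. norm (f' x) \<le> B"
  shows "norm (f x - f y) \<le> B * norm (x - y)"
  using assms
  by (intro differentiable_bound[where S = UNIV and f' = "\<lambda>x. blinfun_apply (f' x)"])
     (auto simp: norm_blinfun.rep_eq)

text \<open>A solution is a fixed point of the contraction \<open>z - f x\<close>. This supplies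
  preimages both under the forward motion along a graph and under
  \<open>predecessor\<close>.\<close>

lemma surj_id_plus_contraction:
  fixes f :: "'a::banach \<Rightarrow> 'a"
  assumes "0 \<le> c" "c < 1" and lip: "\<And>x y. norm (f x - f y) \<le> c * norm (x - y)"
  obtains x where "x + f x = z"
proof -
  have "\<exists>!x. z - f x = x"
    by (rule banach_fix_type[OF assms(1,2)]) (use lip in \<open>auto simp: dist_norm norm_minus_commute\<close>)
  then obtain x where "z - f x = x" by blast
  then have "x + f x = z" by (simp add: algebra_simps)
  then show thesis by (rule that)
qed

section \<open>Symmetry of second derivatives\<close>

text \<open>The mean value theorem along \<open>u\<close> reduces the second difference of
  \<open>L\<close> to a first difference of \<open>G\<close> along \<open>v\<close>, which
  \<open>H x\<close> predicts up to the Lipschitz error of \<open>H\<close>. The error is cubic in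
  \<open>s\<close> while the main term is quadratic.\<close>

lemma second_difference_estimate:
  fixes L :: "'a::real_inner \<Rightarrow> real"
  assumes grad: "\<And>x. (L has_derivative (\<lambda>u. G x \<bullet> u)) (at x)"
    and hess: "\<And>x. (G has_derivative blinfun_apply (H x)) (at x)"
    and lip: "\<And>x y. norm (H x - H y) \<le> d * norm (x - y)"
    and d: "0 \<le> d" and s: "0 < s"
  shows "\<bar>(L (x + s *\<^sub>R u + s *\<^sub>R v) - L (x + s *\<^sub>R u) - L (x + s *\<^sub>R v) + L x) - s\<^sup>2 * (H x v \<bullet> u)\<bar>
    \<le> s ^ 3 * (d * (norm u + norm v) * norm v * norm u)"
proof -
  define \<phi> where "\<phi> = (\<lambda>\<tau>. L (x + \<tau> *\<^sub>R u + s *\<^sub>R v) - L (x + \<tau> *\<^sub>R u))"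
  have L_line: "((\<lambda>\<tau>. L (y + \<tau> *\<^sub>R u)) has_derivative (\<lambda>k. k * (G (y + \<tau> *\<^sub>R u) \<bullet> u))) (at \<tau>)" for y \<tau>
  proof -
    have "((\<lambda>\<tau>. y + \<tau> *\<^sub>R u) has_derivative (\<lambda>k. k *\<^sub>R u)) (at \<tau>)"
      by (auto intro!: derivative_eq_intros)
    from has_derivative_compose[OF this grad] show ?thesis by simp
  qed
  have deriv: "(\<phi> has_derivative (\<lambda>k. k * ((G (x + \<tau> *\<^sub>R u + s *\<^sub>R v) - G (x + \<tau> *\<^sub>R u)) \<bullet> u))) (at \<tau>)" for \<tau>
    using has_derivative_diff[OF L_line[of "x + s *\<^sub>R v" \<tau>] L_line[of x \<tau>]]
    unfolding \<phi>_def by (simp add: algebra_simps)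
  obtain \<tau> where \<tau>: "0 < \<tau>" "\<tau> < s"
    and eq: "\<phi> s - \<phi> 0 = s * ((G (x + \<tau> *\<^sub>R u + s *\<^sub>R v) - G (x + \<tau> *\<^sub>R u)) \<bullet> u)"
    using mvt_simple[OF s, of \<phi>, OF has_derivative_at_withinI[OF deriv]] by auto
  let ?y = "x + \<tau> *\<^sub>R u"
  let ?\<rho> = "s * (norm u + norm v)"
  \<comment> \<open>Subtracting the linear map \<open>H x\<close> from \<open>G\<close> leaves a map
    with derivative \<open>H y - H x\<close>, which is small on a ball around \<open>x\<close>
    containing both end points.\<close>
  have "norm ((G (?y + s *\<^sub>R v) - H x (?y + s *\<^sub>R v)) - (G ?y - H x ?y)) \<le> (d * ?\<rho>) * norm ((?y + s *\<^sub>R v) - ?y)"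
  proof (rule differentiable_bound[where S = "cball x ?\<rho>" and f' = "\<lambda>y. blinfun_apply (H y - H x)"])
    have tu: "\<tau> * norm u \<le> s * norm u" using \<tau> by (simp add: mult_right_mono)
    have "norm (\<tau> *\<^sub>R u) \<le> ?\<rho>" using \<tau> s tu by (simp add: distrib_left add_increasing2)
    then show "?y \<in> cball x ?\<rho>" by (simp add: dist_norm)
    have "norm (\<tau> *\<^sub>R u + s *\<^sub>R v) \<le> ?\<rho>"
      using norm_triangle_ineq[of "\<tau> *\<^sub>R u" "s *\<^sub>R v"] \<tau> s tu by (simp add: distrib_left)
    then show "?y + s *\<^sub>R v \<in> cball x ?\<rho>" by (simp add: dist_norm norm_minus_commute algebra_simps)
    fix y assume y: "y \<in> cball x ?\<rho>"
    show "((\<lambda>y. G y - H x y) has_derivative blinfun_apply (H y - H x)) (at y within cball x ?\<rho>)"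
      by (auto intro!: derivative_eq_intros has_derivative_at_withinI[OF hess] simp: blinfun.diff_left)
    have "norm (H y - H x) \<le> d * norm (y - x)" by (rule lip)
    also have "\<dots> \<le> d * ?\<rho>"
      using y d by (intro mult_left_mono) (auto simp: dist_norm norm_minus_commute)
    finally show "onorm (blinfun_apply (H y - H x)) \<le> d * ?\<rho>" by (simp add: norm_blinfun.rep_eq)
  qed simp
  then have "norm (G (?y + s *\<^sub>R v) - G ?y - s *\<^sub>R H x v) \<le> d * ?\<rho> * (s * norm v)"
    using s by (simp add: blinfun.add_right blinfun.scaleR_right algebra_simps)
  then have "\<bar>(G (?y + s *\<^sub>R v) - G ?y - s *\<^sub>R H x v) \<bullet> u\<bar> \<le> d * ?\<rho> * (s * norm v) * norm u"
    by (meson Cauchy_Schwarz_ineq2 mult_right_mono norm_ge_zero order_trans)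
  then have "s * \<bar>(G (?y + s *\<^sub>R v) - G ?y - s *\<^sub>R H x v) \<bullet> u\<bar> \<le> s * (d * ?\<rho> * (s * norm v) * norm u)"
    using s by (intro mult_left_mono) auto
  also have "\<dots> = s ^ 3 * (d * (norm u + norm v) * norm v * norm u)"
    by (simp add: power3_eq_cube)
  also have "s * \<bar>(G (?y + s *\<^sub>R v) - G ?y - s *\<^sub>R H x v) \<bullet> u\<bar> = \<bar>(\<phi> s - \<phi> 0) - s\<^sup>2 * (H x v \<bullet> u)\<bar>"
  proof -
    have "(\<phi> s - \<phi> 0) - s\<^sup>2 * (H x v \<bullet> u) = s * ((G (?y + s *\<^sub>R v) - G ?y - s *\<^sub>R H x v) \<bullet> u)"
      by (simp add: eq power2_eq_square inner_diff_left algebra_simps)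
    then show ?thesis using s by (simp add: abs_mult)
  qed
  finally show ?thesis by (simp add: \<phi>_def algebra_simps)
qed

text \<open>The second difference of \<open>L\<close> is symmetric in \<open>u\<close> and
  \<open>v\<close>, so it approximates both mixed derivatives; divide by the square of
  \<open>s\<close> and let \<open>s\<close> tend to 0.\<close>

lemma hessian_symmetric:
  fixes L :: "'a::real_inner \<Rightarrow> real"
  assumes grad: "\<And>x. (L has_derivative (\<lambda>u. G x \<bullet> u)) (at x)"
    and hess: "\<And>x. (G has_derivative blinfun_apply (H x)) (at x)"
    and lip: "\<And>x y. norm (H x - H y) \<le> d * norm (x - y)"
    and d: "0 \<le> d"
  shows "H x u \<bullet> v = u \<bullet> H x v"
proof -
  define c where "c = 2 * (d * (norm u + norm v) * norm v * norm u)"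
  have bound: "\<bar>H x u \<bullet> v - H x v \<bullet> u\<bar> \<le> s * c" if s: "0 < s" for s
  proof -
    have "\<bar>s\<^sup>2 * (H x u \<bullet> v) - s\<^sup>2 * (H x v \<bullet> u)\<bar> \<le> s ^ 3 * c"
      using second_difference_estimate[OF grad hess lip d s, of x u v]
        second_difference_estimate[OF grad hess lip d s, of x v u]
      unfolding c_def by (simp add: algebra_simps)
    then have "s\<^sup>2 * \<bar>H x u \<bullet> v - H x v \<bullet> u\<bar> \<le> s\<^sup>2 * (s * c)"
      by (simp add: abs_mult power2_eq_square power3_eq_cube flip: right_diff_distrib)
    then show ?thesis using s by simp
  qed
  have "((\<lambda>s. s * c) \<longlongrightarrow> 0 * c) (at_right 0)"
    by (intro tendsto_intros)
  then have "\<bar>H x u \<bullet> v - H x v \<bullet> u\<bar> \<le> 0 * c"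
    by (rule tendsto_lowerbound) (auto simp: eventually_at_right_less eventually_mono[OF eventually_at_right_less bound])
  then show ?thesis by (simp add: inner_commute)
qed


section \<open>Geometric convergence and composition estimates\<close>

text \<open>The distance to the limit is a tail of the telescoping series, dominated by a geometric
  tail that does not depend on \<open>x\<close>. It serves the iterates and their derivatives
  alike.\<close>

lemma geometric_uniform_limit:
  fixes f :: "nat \<Rightarrow> 'a \<Rightarrow> 'b::banach"
  assumes step: "\<And>n x. norm (f (Suc n) x - f n x) \<le> c * \<rho> ^ n" and \<rho>: "0 \<le> \<rho>" "\<rho> < 1"
  shows "\<exists>F. \<forall>n x. norm (f n x - F x) \<le> c * \<rho> ^ n / (1 - \<rho>)"
proof -
  have geo: "summable (\<lambda>k. c * \<rho> ^ (k + n))" for n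
    using \<rho> by (simp add: summable_mult summable_ignore_initial_segment)
  have summ: "summable (\<lambda>k. f (Suc k) x - f k x)" for x
    using geo[of 0] by (rule summable_comparison_test'[where N = 0]) (use step in auto)
  define F where "F = (\<lambda>x. f 0 x + (\<Sum>k. f (Suc k) x - f k x))"
  have "norm (f n x - F x) \<le> c * \<rho> ^ n / (1 - \<rho>)" for n x
  proof -
    have "F x = f 0 x + ((\<Sum>k. f (Suc (k + n)) x - f (k + n) x) + (\<Sum>k<n. f (Suc k) x - f k x))"
      unfolding F_def by (subst suminf_split_initial_segment[OF summ, of _ n]) simp
    then have "F x - f n x = (\<Sum>k. f (Suc (k + n)) x - f (k + n) x)"
      by (simp add: sum_lessThan_telescope[of "\<lambda>k. f k x"])
    also have "norm \<dots> \<le> (\<Sum>k. c * \<rho> ^ (k + n))"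
      by (rule norm_suminf_le[OF step geo])
    also have "\<dots> = (\<Sum>k. (c * \<rho> ^ n) * \<rho> ^ k)" by (simp add: power_add mult_ac)
    also have "\<dots> = c * \<rho> ^ n / (1 - \<rho>)"
      using \<rho> by (subst suminf_mult) (auto simp: suminf_geometric)
    finally show ?thesis by (simp add: norm_minus_commute)
  qed
  then show ?thesis by blast
qed

lemma norm_blinfun_compose_diff_le:
  "norm ((S o\<^sub>L A) - (S' o\<^sub>L A')) \<le> norm (S - S') * norm A + norm S' * norm (A - A')"
proof -
  have "(S o\<^sub>L A) - (S' o\<^sub>L A') = ((S - S') o\<^sub>L A) + (S' o\<^sub>L (A - A'))"
    by (intro blinfun_eqI) (simp add: blinfun.diff_left blinfun.diff_right blinfun.add_left)
  then show ?thesis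
    by (metis add_mono norm_blinfun_compose norm_triangle_le)
qed

lemma eq_zero_if_geometrically_small:
  fixes a K q :: real
  assumes "\<And>n. \<bar>a\<bar> \<le> q ^ n * K" "0 \<le> q" "q < 1"
  shows "a = 0"
proof -
  have "(\<lambda>n. q ^ n * K) \<longlonglongrightarrow> 0 * K"
    by (intro tendsto_intros LIMSEQ_realpow_zero assms)
  then have "\<bar>a\<bar> \<le> 0 * K"
    by (rule LIMSEQ_le_const) (use assms in auto)
  then show ?thesis by simp
qed

section \<open>Setting, constants and contraction rates\<close>

text \<open>The loss itself is absent: all that is kept of it is that its Hessian \<open>H\<close>
  is symmetric. The smallness condition is \<open>4 * t < 1 - r\<close> in the constants
  below.\<close>

locale heavy_ball =
  fixes \<beta> h d1 d2 d3 :: real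
    and G :: "'a::euclidean_space \<Rightarrow> 'a" and H :: "'a \<Rightarrow> 'a \<Rightarrow>\<^sub>L 'a"
  assumes beta: "0 < \<beta>" "\<beta> < 1"
    and h_pos: "0 < h"
    and d_pos: "0 < d1" "0 < d2" "0 < d3"
    and G_deriv: "\<And>x. (G has_derivative blinfun_apply (H x)) (at x)"
    and G_bound: "\<And>x. norm (G x) \<le> d1"
    and H_bound: "\<And>x. norm (H x) \<le> d2"
    and H_lipschitz: "\<And>x y. norm (H x - H y) \<le> d3 * norm (x - y)"
    and H_symmetric: "\<And>x u v. H x u \<bullet> v = u \<bullet> H x v"
    and h_small: "h * (2 * d2 / (1 - \<beta>)) < (1 - \<beta>) / 8"
begin

text \<open>\<open>m\<close>, \<open>l\<close> and \<open>\<Lambda>\<close> will bound the field,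
  its derivative and the Lipschitz constant of the derivative. \<open>m\<close> exactly reproduces
  itself under \<open>\<beta> * m + d1\<close>; \<open>l\<close> and \<open>\<Lambda>\<close> are
  twice as large as the analogous values, which leaves the reserve factor \<open>r < 1\<close> to
  absorb the stretching \<open>1 + t\<close> of \<open>predecessor\<close>.\<close>

definition m where "m = d1 / (1 - \<beta>)"
definition l where "l = 2 * d2 / (1 - \<beta>)"
definition \<Lambda> where "\<Lambda> = 2 * d3 / (1 - \<beta>)"
definition r where "r = (1 + \<beta>) / 2"
definition t where "t = h * l"
definition \<rho> where "\<rho> = r * ((1 + t)\<^sup>2 + t)"
definition \<rho>\<^sub>1 where "\<rho>\<^sub>1 = \<beta> * (1 + t) + r * t"

lemma m_eq: "\<beta> * m + d1 = m" and l_eq: "\<beta> * l + d2 = r * l" and \<Lambda>_eq: "\<beta> * \<Lambda> + d3 = r * \<Lambda>"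
  using beta by (auto simp: m_def l_def \<Lambda>_def r_def field_simps)

lemma m_pos: "0 < m" and l_pos: "0 < l" and \<Lambda>_pos: "0 < \<Lambda>"
  using beta d_pos by (auto simp: m_def l_def \<Lambda>_def)

lemma r_bounds: "\<beta> < r" "0 < r" "r < 1"
  using beta by (auto simp: r_def)

lemma t_bounds: "0 < t" "4 * t < 1 - r"
proof -
  show "0 < t" using h_pos l_pos by (simp add: t_def)
  show "4 * t < 1 - r" using h_small by (simp add: t_def l_def r_def field_simps)
qed

lemma \<rho>_less_1: "\<rho> < 1"
proof -
  have "t < 1" using t_bounds r_bounds by simp
  then have "t * t \<le> t * 1" using t_bounds by (intro mult_left_mono) auto
  then have "(1 + t)\<^sup>2 + t \<le> 1 + 4 * t" by (simp add: power2_eq_square algebra_simps)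
  then have "\<rho> \<le> r * (1 + 4 * t)" unfolding \<rho>_def using r_bounds by (intro mult_left_mono) auto
  also have "\<dots> = r + r * (4 * t)" by (simp add: algebra_simps)
  also have "r * (4 * t) \<le> 1 * (4 * t)" using r_bounds t_bounds by (intro mult_right_mono) auto
  finally show ?thesis using t_bounds by simp
qed

text \<open>\<open>\<beta> + r * t\<close> is the sup-norm rate of \<open>step\<close>, and
  \<open>\<rho>\<^sub>1\<close> the rate for derivatives; the gap between
  \<open>\<rho>\<^sub>1\<close> and \<open>\<rho>\<close> leaves room for a forcing term.
  \<open>r * (1 + t) \<le> 1\<close> preserves the derivative bound, and the last inequality forces
  symmetry of the Jacobian.\<close>

lemma rates: "0 < \<rho>" "\<beta> + r * t \<le> \<rho>\<^sub>1" "\<rho>\<^sub>1 < \<rho>" "r * (1 + t) \<le> 1" "\<beta> * (1 + t)\<^sup>2 < 1"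
proof -
  have sq: "1 + t \<le> (1 + t)\<^sup>2" using t_bounds by (simp add: power2_eq_square algebra_simps)
  have "\<beta> * (1 + t) < r * (1 + t)" "\<beta> * (1 + t)\<^sup>2 < r * (1 + t)\<^sup>2"
    using r_bounds t_bounds by (auto intro!: mult_strict_right_mono)
  moreover have "r * (1 + t) \<le> r * (1 + t)\<^sup>2" using sq r_bounds by simp
  moreover have "\<rho> = r * (1 + t)\<^sup>2 + r * t" by (simp add: \<rho>_def algebra_simps)
  moreover have "0 < r * t" "0 < \<beta> * t" "0 < \<beta> * (1 + t)" using r_bounds t_bounds beta by auto
  ultimately show "0 < \<rho>" "\<beta> + r * t \<le> \<rho>\<^sub>1" "\<rho>\<^sub>1 < \<rho>" "r * (1 + t) \<le> 1" "\<beta> * (1 + t)\<^sup>2 < 1"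
    using \<rho>_less_1 unfolding \<rho>\<^sub>1_def by (auto simp: distrib_left[of _ 1])
qed

lemma G_lipschitz: "norm (G x - G y) \<le> d2 * norm (x - y)"
  by (rule lipschitz_of_blinfun_derivative_bound[OF G_deriv H_bound])

section \<open>The backward operator and its invariant class\<close>

definition predecessor :: "('a \<Rightarrow> 'a) \<Rightarrow> 'a \<Rightarrow> 'a" where
  "predecessor w x = x - h *\<^sub>R w x"

text \<open>The predecessor is taken along \<open>w\<close> itself, not along the new field, so the
  operator is explicit. It differs from the usual graph transform, but at a fixed point the two
  fields coincide.\<close>

definition step :: "('a \<Rightarrow> 'a) \<Rightarrow> 'a \<Rightarrow> 'a" where
  "step w x = \<beta> *\<^sub>R w (predecessor w x) - G (predecessor w x)"

definition slope :: "('a \<Rightarrow> 'a) \<Rightarrow> ('a \<Rightarrow> 'a \<Rightarrow>\<^sub>L 'a) \<Rightarrow> 'a \<Rightarrow> 'a \<Rightarrow>\<^sub>L 'a" where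
  "slope w W x = \<beta> *\<^sub>R W (predecessor w x) - H (predecessor w x)"

text \<open>The chain rule for \<open>step\<close>: \<open>slope\<close> is the derivative of the
  outer field at the predecessor, and the right factor is the derivative of
  \<open>predecessor\<close>. \<open>W\<close> is a separate argument so that derivatives can be
  iterated alongside the fields.\<close>

definition dstep :: "('a \<Rightarrow> 'a) \<Rightarrow> ('a \<Rightarrow> 'a \<Rightarrow>\<^sub>L 'a) \<Rightarrow> 'a \<Rightarrow> 'a \<Rightarrow>\<^sub>L 'a" where
  "dstep w W x = slope w W x o\<^sub>L (id_blinfun - h *\<^sub>R W x)"

definition admissible :: "('a \<Rightarrow> 'a) \<Rightarrow> ('a \<Rightarrow> 'a \<Rightarrow>\<^sub>L 'a) \<Rightarrow> bool" where
  "admissible w W \<longleftrightarrow>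
    (\<forall>x. (w has_derivative blinfun_apply (W x)) (at x)) \<and>
    (\<forall>x. norm (w x) \<le> m) \<and> (\<forall>x. norm (W x) \<le> l) \<and>
    (\<forall>x y. norm (W x - W y) \<le> \<Lambda> * norm (x - y))"

lemma admissibleD:
  assumes "admissible w W"
  shows "(w has_derivative blinfun_apply (W x)) (at x)" "norm (w x) \<le> m" "norm (W x) \<le> l"
    "norm (W x - W y) \<le> \<Lambda> * norm (x - y)"
  using assms unfolding admissible_def by blast+

lemma admissible_lipschitz:
  assumes "admissible w W"
  shows "norm (w x - w y) \<le> l * norm (x - y)"
  using admissibleD(1,3)[OF assms] by (rule lipschitz_of_blinfun_derivative_bound)

lemma predecessor_diff:
  assumes "norm (w x - w' x) \<le> a"
  shows "norm (predecessor w x - predecessor w' x) \<le> h * a"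
proof -
  have "predecessor w x - predecessor w' x = - (h *\<^sub>R (w x - w' x))" by (simp add: predecessor_def algebra_simps)
  then have "norm (predecessor w x - predecessor w' x) = h * norm (w x - w' x)" using h_pos by simp
  then show ?thesis using assms h_pos by simp
qed

lemma predecessor_lipschitz:
  assumes "admissible w W"
  shows "norm (predecessor w x - predecessor w y) \<le> (1 + t) * norm (x - y)"
proof -
  have "predecessor w x - predecessor w y = (x - y) - h *\<^sub>R (w x - w y)" by (simp add: predecessor_def algebra_simps)
  also have "norm \<dots> \<le> norm (x - y) + h * norm (w x - w y)"
    using norm_triangle_ineq4[of "x - y" "h *\<^sub>R (w x - w y)"] h_pos by simp
  also have "h * norm (w x - w y) \<le> h * (l * norm (x - y))"
    using admissible_lipschitz[OF assms] h_pos by (intro mult_left_mono) auto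
  finally show ?thesis by (simp add: t_def algebra_simps)
qed

lemma norm_id_minus:
  assumes "norm A \<le> l"
  shows "norm (id_blinfun - h *\<^sub>R A :: 'a \<Rightarrow>\<^sub>L 'a) \<le> 1 + t"
proof -
  have "norm (id_blinfun - h *\<^sub>R A) \<le> norm (id_blinfun :: 'a \<Rightarrow>\<^sub>L 'a) + h * norm A"
    using norm_triangle_ineq4[of "id_blinfun :: 'a \<Rightarrow>\<^sub>L 'a" "h *\<^sub>R A"] h_pos by simp
  also have "norm (id_blinfun :: 'a \<Rightarrow>\<^sub>L 'a) \<le> 1" by (rule norm_blinfun_id_le)
  also have "h * norm A \<le> h * l" using assms h_pos by simp
  finally show ?thesis by (simp add: t_def)
qed

lemma field_lipschitz:
  assumes "admissible w W"
  shows "norm ((\<beta> *\<^sub>R w x - G x) - (\<beta> *\<^sub>R w y - G y)) \<le> r * l * norm (x - y)"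
proof -
  have "(\<beta> *\<^sub>R w x - G x) - (\<beta> *\<^sub>R w y - G y) = \<beta> *\<^sub>R (w x - w y) - (G x - G y)" by (simp add: algebra_simps)
  also have "norm \<dots> \<le> \<beta> * norm (w x - w y) + norm (G x - G y)"
    using norm_triangle_ineq4[of "\<beta> *\<^sub>R (w x - w y)" "G x - G y"] beta by simp
  also have "\<dots> \<le> \<beta> * (l * norm (x - y)) + d2 * norm (x - y)"
    using admissible_lipschitz[OF assms, of x y] G_lipschitz[of x y] beta by (intro add_mono mult_left_mono) auto
  also have "\<dots> = (\<beta> * l + d2) * norm (x - y)" by (simp add: algebra_simps)
  finally show ?thesis by (simp add: l_eq)
qed

lemma dfield_lipschitz:
  assumes "admissible w W"
  shows "norm ((\<beta> *\<^sub>R W x - H x) - (\<beta> *\<^sub>R W y - H y)) \<le> r * \<Lambda> * norm (x - y)"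
proof -
  have "(\<beta> *\<^sub>R W x - H x) - (\<beta> *\<^sub>R W y - H y) = \<beta> *\<^sub>R (W x - W y) - (H x - H y)" by (simp add: algebra_simps)
  also have "norm \<dots> \<le> \<beta> * norm (W x - W y) + norm (H x - H y)"
    using norm_triangle_ineq4[of "\<beta> *\<^sub>R (W x - W y)" "H x - H y"] beta by simp
  also have "\<dots> \<le> \<beta> * (\<Lambda> * norm (x - y)) + d3 * norm (x - y)"
    using admissibleD(4)[OF assms, of x y] H_lipschitz[of x y] beta by (intro add_mono mult_left_mono) auto
  also have "\<dots> = (\<beta> * \<Lambda> + d3) * norm (x - y)" by (simp add: algebra_simps)
  finally show ?thesis by (simp add: \<Lambda>_eq)
qed

lemma slope_bound:
  assumes "admissible w W"
  shows "norm (slope w W x) \<le> r * l"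
proof -
  let ?y = "predecessor w x"
  have "norm (slope w W x) \<le> \<beta> * norm (W ?y) + norm (H ?y)"
    unfolding slope_def using norm_triangle_ineq4[of "\<beta> *\<^sub>R W ?y" "H ?y"] beta by simp
  also have "\<dots> \<le> \<beta> * l + d2"
    using admissibleD(3)[OF assms] H_bound beta by (intro add_mono mult_left_mono) auto
  finally show ?thesis by (simp add: l_eq)
qed

text \<open>The bounds close up by the choice of constants. For the Lipschitz constant of the
  derivative, \<open>(1 + t)\<^sup>2\<close> comes from moving the base point of
  \<open>slope\<close> and from the norm of the right factor, and \<open>t\<close> from varying the
  right factor; multiplied by \<open>r\<close> the total is \<open>\<rho>\<close>.\<close>

lemma admissible_step:
  assumes adm: "admissible w W"
  shows "admissible (step w) (dstep w W)"
  unfolding admissible_def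
proof (intro conjI allI)
  fix x y
  have predecessor_deriv: "(predecessor w has_derivative blinfun_apply (id_blinfun - h *\<^sub>R W x)) (at x)"
    unfolding predecessor_def[abs_def]
    by (auto intro!: derivative_eq_intros admissibleD(1)[OF adm] simp: blinfun.diff_left blinfun.scaleR_left)
  have "((\<lambda>y. \<beta> *\<^sub>R w y - G y) has_derivative blinfun_apply (slope w W x)) (at (predecessor w x))"
    unfolding slope_def
    by (auto intro!: derivative_eq_intros admissibleD(1)[OF adm] G_deriv simp: blinfun.diff_left blinfun.scaleR_left)
  from has_derivative_compose[OF predecessor_deriv this]
  show "(step w has_derivative blinfun_apply (dstep w W x)) (at x)"
    by (simp add: step_def[abs_def] dstep_def o_def blinfun_compose.rep_eq)
  have "norm (step w x) \<le> \<beta> * norm (w (predecessor w x)) + norm (G (predecessor w x))"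
    unfolding step_def using norm_triangle_ineq4[of "\<beta> *\<^sub>R w (predecessor w x)" "G (predecessor w x)"] beta by simp
  also have "\<dots> \<le> \<beta> * m + d1"
    using admissibleD(2)[OF adm] G_bound beta by (intro add_mono mult_left_mono) auto
  finally show "norm (step w x) \<le> m" by (simp add: m_eq)
  have "norm (dstep w W x) \<le> norm (slope w W x) * norm (id_blinfun - h *\<^sub>R W x)"
    unfolding dstep_def by (rule norm_blinfun_compose)
  also have "\<dots> \<le> (r * l) * (1 + t)"
    using r_bounds l_pos by (intro mult_mono slope_bound[OF adm] norm_id_minus admissibleD(3)[OF adm]) auto
  also have "\<dots> = l * (r * (1 + t))" by simp
  also have "\<dots> \<le> l * 1" using rates l_pos by (intro mult_left_mono) auto
  finally show "norm (dstep w W x) \<le> l" by simp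
  have A: "norm (h *\<^sub>R W y - h *\<^sub>R W x) \<le> h * (\<Lambda> * norm (x - y))"
    using admissibleD(4)[OF adm, of y x] h_pos
    by (simp add: norm_minus_commute flip: scaleR_diff_right)
  have S: "norm (slope w W x - slope w W y) \<le> r * \<Lambda> * ((1 + t) * norm (x - y))"
    unfolding slope_def
    by (rule order_trans[OF dfield_lipschitz[OF adm] mult_left_mono[OF predecessor_lipschitz[OF adm]]])
      (use r_bounds \<Lambda>_pos in auto)
  have "norm (dstep w W x - dstep w W y)
    \<le> norm (slope w W x - slope w W y) * norm (id_blinfun - h *\<^sub>R W x)
      + norm (slope w W y) * norm (h *\<^sub>R W y - h *\<^sub>R W x)"
    unfolding dstep_def
    using norm_blinfun_compose_diff_le[of "slope w W x" "id_blinfun - h *\<^sub>R W x" "slope w W y" "id_blinfun - h *\<^sub>R W y"]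
    by simp
  also have "\<dots> \<le> (r * \<Lambda> * ((1 + t) * norm (x - y))) * (1 + t) + (r * l) * (h * (\<Lambda> * norm (x - y)))"
    using r_bounds l_pos \<Lambda>_pos t_bounds
    by (intro add_mono mult_mono slope_bound[OF adm] norm_id_minus admissibleD(3)[OF adm] S A) auto
  also have "\<dots> = \<rho> * (\<Lambda> * norm (x - y))"
    by (simp add: \<rho>_def t_def power2_eq_square algebra_simps)
  also have "\<dots> \<le> 1 * (\<Lambda> * norm (x - y))"
    using \<rho>_less_1 \<Lambda>_pos by (intro mult_right_mono) auto
  finally show "norm (dstep w W x - dstep w W y) \<le> \<Lambda> * norm (x - y)" by simp
qed

lemma admissible_zero: "admissible (\<lambda>_. 0) (\<lambda>_. 0)"
  using m_pos l_pos \<Lambda>_pos by (auto simp: admissible_def zero_blinfun.rep_eq)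

lemma step_diff:
  assumes adm: "admissible w W" and a: "\<And>x. norm (w x - w' x) \<le> a"
  shows "norm (step w x - step w' x) \<le> \<beta> * a + r * t * a"
proof -
  let ?y = "predecessor w x" and ?y' = "predecessor w' x"
  \<comment> \<open>The two fields are compared at the same point \<open>?y'\<close>; the shift from
    \<open>?y\<close> to \<open>?y'\<close> is charged to \<open>w\<close> alone. Hence
    \<open>w'\<close> may be any function uniformly close to \<open>w\<close>.\<close>
  have "step w x - step w' x = \<beta> *\<^sub>R (w ?y' - w' ?y') + ((\<beta> *\<^sub>R w ?y - G ?y) - (\<beta> *\<^sub>R w ?y' - G ?y'))"
    by (simp add: step_def algebra_simps)
  also have "norm \<dots> \<le> \<beta> * norm (w ?y' - w' ?y') + norm ((\<beta> *\<^sub>R w ?y - G ?y) - (\<beta> *\<^sub>R w ?y' - G ?y'))"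
    using norm_triangle_ineq[of "\<beta> *\<^sub>R (w ?y' - w' ?y')"] beta by simp
  also have "\<dots> \<le> \<beta> * a + r * l * (h * a)"
    using beta r_bounds l_pos
    by (intro add_mono mult_left_mono a order_trans[OF field_lipschitz[OF adm] mult_left_mono[OF predecessor_diff[of w x w' a, OF a]]]) auto
  finally show ?thesis by (simp add: t_def mult_ac)
qed

text \<open>A triangular estimate: derivatives contract at rate \<open>\<rho>\<^sub>1\<close>, up to
  a forcing term in \<open>a\<close> that arises because the slopes are evaluated at different
  predecessors.\<close>

lemma dstep_diff:
  assumes adm: "admissible w W" and adm': "admissible w' W'"
    and a: "\<And>x. norm (w x - w' x) \<le> a" and b: "\<And>x. norm (W x - W' x) \<le> b"
  shows "norm (dstep w W x - dstep w' W' x) \<le> \<rho>\<^sub>1 * b + r * \<Lambda> * h * (1 + t) * a"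
proof -
  let ?y = "predecessor w x" and ?y' = "predecessor w' x"
  have a0: "0 \<le> a" using a[of x] norm_ge_zero[of "w x - w' x"] by linarith
  have b0: "0 \<le> b" using b[of x] norm_ge_zero[of "W x - W' x"] by linarith
  have "slope w W x - slope w' W' x
      = \<beta> *\<^sub>R (W ?y' - W' ?y') + ((\<beta> *\<^sub>R W ?y - H ?y) - (\<beta> *\<^sub>R W ?y' - H ?y'))"
    by (simp add: slope_def algebra_simps)
  also have "norm \<dots> \<le> \<beta> * norm (W ?y' - W' ?y') + norm ((\<beta> *\<^sub>R W ?y - H ?y) - (\<beta> *\<^sub>R W ?y' - H ?y'))"
    using norm_triangle_ineq[of "\<beta> *\<^sub>R (W ?y' - W' ?y')"] beta by simp
  also have "\<dots> \<le> \<beta> * b + r * \<Lambda> * (h * a)"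
    using beta r_bounds \<Lambda>_pos
    by (intro add_mono mult_left_mono b order_trans[OF dfield_lipschitz[OF adm] mult_left_mono[OF predecessor_diff[of w x w' a, OF a]]]) auto
  finally have S: "norm (slope w W x - slope w' W' x) \<le> \<beta> * b + r * \<Lambda> * (h * a)" .
  have A: "norm (h *\<^sub>R W' x - h *\<^sub>R W x) \<le> h * b"
    using b[of x] h_pos by (simp add: norm_minus_commute flip: scaleR_diff_right)
  have "norm (dstep w W x - dstep w' W' x)
    \<le> norm (slope w W x - slope w' W' x) * norm (id_blinfun - h *\<^sub>R W x)
      + norm (slope w' W' x) * norm (h *\<^sub>R W' x - h *\<^sub>R W x)"
    unfolding dstep_def
    using norm_blinfun_compose_diff_le[of "slope w W x" "id_blinfun - h *\<^sub>R W x" "slope w' W' x" "id_blinfun - h *\<^sub>R W' x"]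
    by simp
  also have "\<dots> \<le> (\<beta> * b + r * \<Lambda> * (h * a)) * (1 + t) + (r * l) * (h * b)"
    using r_bounds l_pos \<Lambda>_pos t_bounds a0 b0 beta h_pos
    by (intro add_mono mult_mono slope_bound[OF adm'] norm_id_minus admissibleD(3)[OF adm] S A) auto
  also have "\<dots> = \<rho>\<^sub>1 * b + r * \<Lambda> * h * (1 + t) * a"
    by (simp add: \<rho>\<^sub>1_def t_def algebra_simps)
  finally show ?thesis .
qed

section \<open>Existence and uniqueness of the fixed point\<close>

primrec iter :: "nat \<Rightarrow> 'a \<Rightarrow> 'a" where
  "iter 0 = (\<lambda>_. 0)"
| "iter (Suc n) = step (iter n)"

primrec diter :: "nat \<Rightarrow> 'a \<Rightarrow> 'a \<Rightarrow>\<^sub>L 'a" where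
  "diter 0 = (\<lambda>_. 0)"
| "diter (Suc n) = dstep (iter n) (diter n)"

lemma admissible_iter: "admissible (iter n) (diter n)"
  by (induction n) (auto intro: admissible_zero admissible_step)

lemma iter_diff: "norm (iter (Suc n) x - iter n x) \<le> m * \<rho> ^ n"
proof (induction n arbitrary: x)
  case 0
  then show ?case using admissibleD(2)[OF admissible_iter, of "Suc 0"] by simp
next
  case (Suc n)
  have "norm (iter (Suc (Suc n)) x - iter (Suc n) x) \<le> \<beta> * (m * \<rho> ^ n) + r * t * (m * \<rho> ^ n)"
    using step_diff[OF admissible_iter Suc.IH] by simp
  also have "\<dots> = (\<beta> + r * t) * (m * \<rho> ^ n)" by (simp add: algebra_simps)
  also have "\<dots> \<le> \<rho> * (m * \<rho> ^ n)"
    using rates m_pos by (intro mult_right_mono) auto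
  finally show ?case by (simp add: mult_ac)
qed

text \<open>The summand \<open>l\<close> covers the first difference. The other makes
  \<open>M\<close> absorb the forcing term of \<open>dstep_diff\<close>, which decays like the
  powers of \<open>\<rho>\<close>: the gap \<open>\<rho> - \<rho>\<^sub>1\<close> times
  \<open>M\<close> dominates its coefficient.\<close>

definition M where "M = l + r * \<Lambda> * h * (1 + t) * m / (\<rho> - \<rho>\<^sub>1)"

lemma diter_diff: "norm (diter (Suc n) x - diter n x) \<le> M * \<rho> ^ n"
proof (induction n arbitrary: x)
  case 0
  have "0 \<le> r * \<Lambda> * h * (1 + t) * m / (\<rho> - \<rho>\<^sub>1)"
    using rates r_bounds \<Lambda>_pos h_pos t_bounds m_pos by auto
  moreover have "norm (diter (Suc 0) x) \<le> l" by (rule admissibleD(3)[OF admissible_iter])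
  ultimately show ?case by (simp add: M_def)
next
  case (Suc n)
  let ?C = "r * \<Lambda> * h * (1 + t) * m"
  have "?C \<le> (\<rho> - \<rho>\<^sub>1) * M"
  proof -
    have "(\<rho> - \<rho>\<^sub>1) * M = (\<rho> - \<rho>\<^sub>1) * l + ?C" using rates by (simp add: M_def distrib_left)
    moreover have "0 \<le> (\<rho> - \<rho>\<^sub>1) * l" using rates l_pos by simp
    ultimately show ?thesis by simp
  qed
  then have "\<rho>\<^sub>1 * M + ?C \<le> \<rho> * M" by (simp add: algebra_simps)
  then have "(\<rho>\<^sub>1 * M + ?C) * \<rho> ^ n \<le> (\<rho> * M) * \<rho> ^ n"
    using rates by (intro mult_right_mono) auto
  moreover have "norm (diter (Suc (Suc n)) x - diter (Suc n) x)
      \<le> \<rho>\<^sub>1 * (M * \<rho> ^ n) + r * \<Lambda> * h * (1 + t) * (m * \<rho> ^ n)"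
    using dstep_diff[OF admissible_iter admissible_iter iter_diff Suc.IH] by simp
  ultimately show ?case by (simp add: algebra_simps)
qed

lemma fixed_point_exists:
  obtains w W where "admissible w W" "step w = w"
proof -
  obtain V where V: "\<And>n x. norm (iter n x - V x) \<le> m * \<rho> ^ n / (1 - \<rho>)"
    using geometric_uniform_limit[of iter m \<rho>, OF iter_diff less_imp_le[OF rates(1)] \<rho>_less_1] by blast
  obtain W where W: "\<And>n x. norm (diter n x - W x) \<le> M * \<rho> ^ n / (1 - \<rho>)"
    using geometric_uniform_limit[of diter M \<rho>, OF diter_diff less_imp_le[OF rates(1)] \<rho>_less_1] by blast
  have geo: "(\<lambda>n. c * \<rho> ^ n / (1 - \<rho>)) \<longlonglongrightarrow> 0" for c
    using tendsto_mult[OF tendsto_const[of "c / (1 - \<rho>)"] LIMSEQ_realpow_zero[of \<rho>]] rates \<rho>_less_1 by simp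
  have lim: "(\<lambda>n. iter n x) \<longlonglongrightarrow> V x" for x
    by (subst LIM_zero_iff[symmetric]) (rule Lim_null_comparison[OF always_eventually geo[of m]], use V in auto)
  have dlim: "(\<lambda>n. diter n x) \<longlonglongrightarrow> W x" for x
    by (subst LIM_zero_iff[symmetric]) (rule Lim_null_comparison[OF always_eventually geo[of M]], use W in auto)
  \<comment> \<open>Uniform convergence of the derivatives makes \<open>W\<close> the derivative of
    the limit; by uniqueness of limits the field obtained here is \<open>V\<close>.\<close>
  have "\<exists>w. \<forall>x\<in>UNIV. (\<lambda>n. iter n x) \<longlonglongrightarrow> w x \<and> (w has_derivative blinfun_apply (W x)) (at x within UNIV)"
  proof (rule has_derivative_sequence)
    show "(iter n has_derivative blinfun_apply (diter n x)) (at x within UNIV)" for n x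
      using admissibleD(1)[OF admissible_iter] by simp
    fix e :: real assume "0 < e"
    with geo[of M] have "\<forall>\<^sub>F n in sequentially. M * \<rho> ^ n / (1 - \<rho>) < e"
      by (rule order_tendstoD)
    then show "\<forall>\<^sub>F n in sequentially. \<forall>x\<in>UNIV. \<forall>u. norm (diter n x u - W x u) \<le> e * norm u"
    proof (rule eventually_mono, intro ballI allI)
      fix n x u assume n: "M * \<rho> ^ n / (1 - \<rho>) < e"
      have "norm (diter n x u - W x u) \<le> norm (diter n x - W x) * norm u"
        using norm_blinfun[of "diter n x - W x" u] by (simp add: blinfun.diff_left)
      also have "\<dots> \<le> e * norm u"
        using W[of n x] n by (intro mult_right_mono) auto
      finally show "norm (diter n x u - W x u) \<le> e * norm u" .
    qed
  qed (use lim in auto)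
  then have V_deriv: "(V has_derivative blinfun_apply (W x)) (at x)" for x
    using LIMSEQ_unique[OF lim] by (metis UNIV_I ext)
  have adm: "admissible V W"
    unfolding admissible_def
  proof (intro conjI allI V_deriv)
    show "norm (V x) \<le> m" for x
      by (rule LIMSEQ_le_const2[OF tendsto_norm[OF lim]]) (use admissibleD(2)[OF admissible_iter] in blast)
    show "norm (W x) \<le> l" for x
      by (rule LIMSEQ_le_const2[OF tendsto_norm[OF dlim]]) (use admissibleD(3)[OF admissible_iter] in blast)
    show "norm (W x - W y) \<le> \<Lambda> * norm (x - y)" for x y
      by (rule LIMSEQ_le_const2[OF tendsto_norm[OF tendsto_diff[OF dlim dlim]]])
        (use admissibleD(4)[OF admissible_iter] in blast)
  qed
  have "step V x = V x" for x
  proof -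
    have "(\<lambda>n. \<beta> * (m * \<rho> ^ n / (1 - \<rho>)) + r * t * (m * \<rho> ^ n / (1 - \<rho>))) \<longlonglongrightarrow> \<beta> * 0 + r * t * 0"
      by (intro tendsto_intros geo)
    then have null: "(\<lambda>n. \<beta> * (m * \<rho> ^ n / (1 - \<rho>)) + r * t * (m * \<rho> ^ n / (1 - \<rho>))) \<longlonglongrightarrow> 0"
      by simp
    \<comment> \<open>\<open>iter (Suc n)\<close> is \<open>step (iter n)\<close>, so
      \<open>step_diff\<close> applies with the limit \<open>V\<close> as the admissible
      field.\<close>
    have le: "norm (step V x - iter (Suc n) x)
        \<le> \<beta> * (m * \<rho> ^ n / (1 - \<rho>)) + r * t * (m * \<rho> ^ n / (1 - \<rho>))" for n
      unfolding iter.simps by (rule step_diff[OF adm]) (use V in \<open>simp add: norm_minus_commute\<close>)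
    have "(\<lambda>n. step V x - iter (Suc n) x) \<longlonglongrightarrow> 0"
      by (rule Lim_null_comparison[OF always_eventually null]) (use le in blast)
    moreover have "(\<lambda>n. step V x - iter (Suc n) x) \<longlonglongrightarrow> step V x - V x"
      by (intro tendsto_diff tendsto_const LIMSEQ_Suc[OF lim])
    ultimately have "step V x - V x = 0" by (rule LIMSEQ_unique[rotated])
    then show ?thesis by simp
  qed
  then show thesis using that[OF adm] by auto
qed

text \<open>Applying \<open>step\<close> to both fixed points shrinks any uniform bound on their
  difference by \<open>\<rho>\<close>. The competitor is only required to be bounded, as
  \<open>step_diff\<close> asks for regularity of one field only.\<close>

lemma fixed_point_unique:
  assumes adm: "admissible w W" and fp: "step w = w" "step w' = w'"
    and bdd: "\<And>x. norm (w' x) \<le> K"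
  shows "w' = w"
proof
  fix x
  have "norm (w x - w' x) \<le> \<rho> ^ n * (m + K)" for n
  proof (induction n arbitrary: x)
    case 0
    show ?case
      using norm_triangle_ineq4[of "w x" "w' x"] admissibleD(2)[OF adm, of x] bdd[of x] by simp
  next
    case (Suc n)
    have "0 \<le> \<rho> ^ n * (m + K)" using Suc.IH[of x] norm_ge_zero order_trans by blast
    then have "(\<beta> + r * t) * (\<rho> ^ n * (m + K)) \<le> \<rho> * (\<rho> ^ n * (m + K))"
      using rates by (intro mult_right_mono) auto
    then show ?case
      using step_diff[OF adm Suc.IH, of x] fp by (simp add: algebra_simps)
  qed
  then have "norm (w x - w' x) = 0"
    using rates \<rho>_less_1 by (intro eq_zero_if_geometrically_small[of _ \<rho> "m + K"]) auto
  then show "w' x = w x" by simp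
qed

section \<open>Symmetry of the Jacobian\<close>

text \<open>Both sides are derivatives of the same function. The resulting equation for
  \<open>W\<close> drives the symmetry argument.\<close>

lemma fixed_point_derivative:
  assumes adm: "admissible w W" and fp: "step w = w"
  shows "dstep w W = W"
proof
  fix x
  have "blinfun_apply (dstep w W x) = blinfun_apply (W x)"
    using admissibleD(1)[OF admissible_step[OF adm], of x] admissibleD(1)[OF adm, of x] fp
    by (auto intro: has_derivative_unique)
  then show "dstep w W x = W x" by (simp add: blinfun_apply_inject)
qed

text \<open>The heavy-ball map multiplies the symplectic form \<open>d\<theta> \<and> dv\<close> by \<open>\<beta>\<close>. Restricted to the
  invariant graph of \<open>w\<close> this form is the antisymmetric part of the Jacobian of \<open>w\<close>, and going one step
  backwards stretches tangent vectors by at most \<open>1 + t\<close>; since \<open>\<beta> (1 + t)\<^sup>2 < 1\<close> it must vanish.\<close>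

lemma fixed_point_symmetric:
  assumes adm: "admissible w W" and fp: "step w = w"
  shows "W x u \<bullet> v = u \<bullet> W x v"
proof -
  have rec: "W x u \<bullet> v - u \<bullet> W x v =
      \<beta> * (W (predecessor w x) (u - h *\<^sub>R W x u) \<bullet> (v - h *\<^sub>R W x v)
        - (u - h *\<^sub>R W x u) \<bullet> W (predecessor w x) (v - h *\<^sub>R W x v))" for x u v
  proof -
    define p q where "p = u - h *\<^sub>R W x u" and "q = v - h *\<^sub>R W x v"
    have W_eq: "W x z = slope w W x (z - h *\<^sub>R W x z)" for z
    proof -
      have "W x z = dstep w W x z" by (simp add: fixed_point_derivative[OF adm fp])
      then show ?thesis by (simp add: dstep_def blinfun.diff_left blinfun.scaleR_left)
    qed
    \<comment> \<open>Passing from \<open>u\<close>, \<open>v\<close> to \<open>p\<close>,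
      \<open>q\<close> changes both products by the same term
      \<open>h * (W x u \<bullet> W x v)\<close>. In the later step the \<open>H\<close> part of
      \<open>slope\<close> cancels because \<open>H\<close> is symmetric, leaving only the factor
      \<beta>.\<close>
    have "W x u \<bullet> v - u \<bullet> W x v = W x u \<bullet> q - p \<bullet> W x v"
      by (simp add: p_def q_def inner_diff_left inner_diff_right)
    also have "\<dots> = slope w W x p \<bullet> q - p \<bullet> slope w W x q"
      using W_eq[of u] W_eq[of v] by (simp add: p_def q_def)
    also have "\<dots> = \<beta> * (W (predecessor w x) p \<bullet> q - p \<bullet> W (predecessor w x) q)"
      using H_symmetric[of "predecessor w x" p q]
      by (simp add: slope_def blinfun.diff_left blinfun.scaleR_left inner_diff_left inner_diff_right algebra_simps)
    finally show ?thesis by (simp add: p_def q_def)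
  qed
  define q where "q = \<beta> * (1 + t)\<^sup>2"
  have "\<bar>W x u \<bullet> v - u \<bullet> W x v\<bar> \<le> q ^ n * (2 * l * (norm u * norm v))" for n
  proof (induction n arbitrary: x u v)
    case 0
    have "\<bar>W x u \<bullet> v\<bar> \<le> (l * norm u) * norm v" for u v
    proof -
      have "norm (W x u) \<le> l * norm u"
        using norm_blinfun[of "W x" u] admissibleD(3)[OF adm, of x] by (meson mult_right_mono norm_ge_zero order_trans)
      then show ?thesis by (meson Cauchy_Schwarz_ineq2 mult_right_mono norm_ge_zero order_trans)
    qed
    from this[of u v] this[of v u] show ?case by (simp add: inner_commute mult_ac)
  next
    case (Suc n)
    have predecessor_norm: "norm (z - h *\<^sub>R W x z) \<le> (1 + t) * norm z" for z
    proof -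
      have "norm ((id_blinfun - h *\<^sub>R W x) z) \<le> norm (id_blinfun - h *\<^sub>R W x) * norm z" by (rule norm_blinfun)
      also have "\<dots> \<le> (1 + t) * norm z"
        by (intro mult_right_mono norm_id_minus admissibleD(3)[OF adm]) auto
      finally show ?thesis by (simp add: blinfun.diff_left blinfun.scaleR_left)
    qed
    have q0: "0 \<le> q ^ n * (2 * l)" using beta l_pos by (simp add: q_def)
    have "\<bar>W x u \<bullet> v - u \<bullet> W x v\<bar>
        \<le> \<beta> * (q ^ n * (2 * l * (norm (u - h *\<^sub>R W x u) * norm (v - h *\<^sub>R W x v))))"
      unfolding rec[of x u v] abs_mult using beta by (intro mult_mono Suc.IH) auto
    also have "\<dots> \<le> \<beta> * (q ^ n * (2 * l * (((1 + t) * norm u) * ((1 + t) * norm v))))"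
      unfolding mult.assoc[symmetric, of "q ^ n" "2 * l"] using beta t_bounds
      by (intro mult_left_mono mult_mono predecessor_norm q0 mult_nonneg_nonneg norm_ge_zero) auto
    also have "\<dots> = q ^ Suc n * (2 * l * (norm u * norm v))"
      by (simp add: q_def power2_eq_square)
    finally show ?case .
  qed
  then have "W x u \<bullet> v - u \<bullet> W x v = 0"
    using rates beta by (intro eq_zero_if_geometrically_small[of _ q "2 * l * (norm u * norm v)"]) (auto simp: q_def)
  then show ?thesis by simp
qed

section \<open>Invariant graphs and attraction\<close>

text \<open>The forward form of the fixed point equation: the heavy-ball step moves \<open>x\<close>
  to \<open>x + h *\<^sub>R v'\<close> with new velocity
  \<open>v' = \<beta> *\<^sub>R w x - G x\<close>, and this point must lie on the graph
  again.\<close>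

definition invariant :: "('a \<Rightarrow> 'a) \<Rightarrow> bool" where
  "invariant w \<longleftrightarrow> (\<forall>x. w (x + h *\<^sub>R (\<beta> *\<^sub>R w x - G x)) = \<beta> *\<^sub>R w x - G x)"

text \<open>Every \<open>z\<close> has to be reached by the forward motion along the graph, which
  holds because that motion is the identity plus a map with Lipschitz constant
  \<open>4 * t < 1\<close>. The constant \<open>5/2 * l\<close> is what competitors for
  \<open>g\<close> provide.\<close>

lemma invariant_imp_fixed_point:
  assumes inv: "invariant w" and lip: "\<And>x y. norm (w x - w y) \<le> (5/2 * l) * norm (x - y)"
  shows "step w = w"
proof
  fix z
  let ?f = "\<lambda>x. h *\<^sub>R (\<beta> *\<^sub>R w x - G x)"
  have "norm (?f x - ?f y) \<le> (4 * t) * norm (x - y)" for x y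
  proof -
    have "?f x - ?f y = h *\<^sub>R (\<beta> *\<^sub>R (w x - w y) - (G x - G y))" by (simp add: algebra_simps)
    then have "norm (?f x - ?f y) \<le> h * (\<beta> * norm (w x - w y) + norm (G x - G y))"
      using norm_triangle_ineq4[of "\<beta> *\<^sub>R (w x - w y)" "G x - G y"] beta h_pos by simp
    also have "\<dots> \<le> h * (1 * ((5/2 * l) * norm (x - y)) + l * norm (x - y))"
    proof (intro mult_left_mono add_mono mult_mono lip)
      have "d2 \<le> l" using beta d_pos by (simp add: l_def field_simps)
      then show "norm (G x - G y) \<le> l * norm (x - y)"
        using G_lipschitz[of x y] by (meson mult_right_mono norm_ge_zero order_trans)
    qed (use beta h_pos in auto)
    also have "\<dots> = 7/2 * (t * norm (x - y))" by (simp add: t_def algebra_simps)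
    also have "\<dots> \<le> 4 * (t * norm (x - y))" using t_bounds by (intro mult_right_mono) auto
    finally show ?thesis by simp
  qed
  then obtain x where x: "x + ?f x = z"
    using surj_id_plus_contraction[of "4 * t" ?f z] t_bounds r_bounds by auto
  have wz: "w z = \<beta> *\<^sub>R w x - G x" using inv x unfolding invariant_def by metis
  have "predecessor w z = x" using x by (simp add: predecessor_def wz algebra_simps)
  then show "step w z = w z" by (simp add: step_def wz)
qed

text \<open>Conversely, every \<open>x\<close> has to be a predecessor; \<open>predecessor w\<close>
  is onto since \<open>t < 1\<close>.\<close>

lemma fixed_point_imp_invariant:
  assumes adm: "admissible w W" and fp: "step w = w"
  shows "invariant w"
  unfolding invariant_def
proof
  fix x
  let ?f = "\<lambda>z. - h *\<^sub>R w z"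
  have "norm (?f z - ?f y) \<le> t * norm (z - y)" for z y
    using mult_left_mono[OF admissible_lipschitz[OF adm, of y z], of h] h_pos
    by (simp add: t_def norm_minus_commute flip: scaleR_diff_right)
  then obtain z where "z + ?f z = x"
    using surj_id_plus_contraction[of t ?f x] t_bounds r_bounds by auto
  then have z: "predecessor w z = x" by (simp add: predecessor_def)
  have "w z = \<beta> *\<^sub>R w x - G x" using fp z by (metis step_def)
  moreover from this have "x + h *\<^sub>R (\<beta> *\<^sub>R w x - G x) = z" using z unfolding predecessor_def by (metis diff_add_cancel)
  ultimately show "w (x + h *\<^sub>R (\<beta> *\<^sub>R w x - G x)) = \<beta> *\<^sub>R w x - G x" by simp
qed

text \<open>Compare with the image \<open>z\<close> of the graph point over \<open>x\<close>: a
  deviation \<open>e\<close> of the velocity becomes \<beta> times \<open>e\<close>, and it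
  displaces the new position from \<open>z\<close> by \<open>(h * \<beta>) *\<^sub>R e\<close>,
  along which \<open>w\<close> varies by at most its Lipschitz constant \<open>l\<close>.\<close>

lemma attraction_step:
  assumes adm: "admissible w W" and inv: "invariant w"
  shows "norm ((\<beta> *\<^sub>R v - G x) - w (x - h *\<^sub>R G x + (h * \<beta>) *\<^sub>R v)) \<le> (\<beta> + h * \<beta> * l) * norm (v - w x)"
proof -
  define e where "e = v - w x"
  define z where "z = x + h *\<^sub>R (\<beta> *\<^sub>R w x - G x)"
  have wz: "w z = \<beta> *\<^sub>R w x - G x" using inv by (simp add: invariant_def z_def)
  have next_eq: "x - h *\<^sub>R G x + (h * \<beta>) *\<^sub>R v = z + (h * \<beta>) *\<^sub>R e" by (simp add: z_def e_def algebra_simps)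
  have "(\<beta> *\<^sub>R v - G x) - w (z + (h * \<beta>) *\<^sub>R e) = \<beta> *\<^sub>R e + (w z - w (z + (h * \<beta>) *\<^sub>R e))"
    by (simp add: wz e_def algebra_simps)
  also have "norm \<dots> \<le> \<beta> * norm e + norm (w z - w (z + (h * \<beta>) *\<^sub>R e))"
    using norm_triangle_ineq[of "\<beta> *\<^sub>R e"] beta by simp
  also have "norm (w z - w (z + (h * \<beta>) *\<^sub>R e)) \<le> l * (h * \<beta> * norm e)"
    using admissible_lipschitz[OF adm, of z "z + (h * \<beta>) *\<^sub>R e"] h_pos beta by simp
  finally show ?thesis unfolding next_eq e_def by (simp add: algebra_simps)
qed

section \<open>Passage between the velocity field and \<open>g\<close>\<close>

text \<open>Stated for any normed space, so that it bounds the values of \<open>g\<close> as well as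
  its derivative and differences of the derivative.\<close>

lemma norm_rescaled_sum_le:
  fixes a b :: "'b::real_normed_vector"
  assumes "norm a \<le> A" "norm b \<le> B"
  shows "norm ((1 / h) *\<^sub>R (a + (1 / (1 - \<beta>)) *\<^sub>R b)) \<le> (A + B / (1 - \<beta>)) / h"
proof -
  have "norm (a + (1 / (1 - \<beta>)) *\<^sub>R b) \<le> norm a + norm b / (1 - \<beta>)"
    using norm_triangle_ineq[of a "(1 / (1 - \<beta>)) *\<^sub>R b"] beta by simp
  also have "\<dots> \<le> A + B / (1 - \<beta>)"
    using assms beta by (intro add_mono divide_right_mono) auto
  finally show ?thesis using h_pos by (simp add: divide_right_mono)
qed

definition velocity :: "('a \<Rightarrow> 'a) \<Rightarrow> 'a \<Rightarrow> 'a" where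
  "velocity g x = - (1 / (1 - \<beta>)) *\<^sub>R G x + h *\<^sub>R g x"

lemma velocity_field: "\<beta> *\<^sub>R velocity g x - G x = - (1 / (1 - \<beta>)) *\<^sub>R G x + (h * \<beta>) *\<^sub>R g x"
proof -
  have "\<beta> / (1 - \<beta>) + 1 = 1 / (1 - \<beta>)" using beta by (simp add: field_simps)
  then have "(1 / (1 - \<beta>)) *\<^sub>R G x = (\<beta> / (1 - \<beta>)) *\<^sub>R G x + G x"
    by (metis scaleR_add_left scaleR_one)
  moreover have "\<beta> *\<^sub>R velocity g x = (h * \<beta>) *\<^sub>R g x - (\<beta> / (1 - \<beta>)) *\<^sub>R G x"
    by (simp add: velocity_def scaleR_diff_right mult.commute)
  ultimately show ?thesis by simp
qed

text \<open>The point \<zeta> is the forward image of \<theta> along the graph of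
  \<open>velocity g\<close>.\<close>

lemma invariant_velocity_iff:
  "invariant (velocity g) \<longleftrightarrow> (\<forall>\<theta>. let \<zeta> = \<theta> - (h / (1 - \<beta>)) *\<^sub>R G \<theta> + (h\<^sup>2 * \<beta>) *\<^sub>R g \<theta> in
    - (1 / (1 - \<beta>)) *\<^sub>R G \<zeta> + h *\<^sub>R g \<zeta> = - (1 / (1 - \<beta>)) *\<^sub>R G \<theta> + (h * \<beta>) *\<^sub>R g \<theta>)"
proof -
  have forward_eq: "\<theta> + h *\<^sub>R (- (1 / (1 - \<beta>)) *\<^sub>R G \<theta> + (h * \<beta>) *\<^sub>R g \<theta>)
      = \<theta> - (h / (1 - \<beta>)) *\<^sub>R G \<theta> + (h\<^sup>2 * \<beta>) *\<^sub>R g \<theta>" for \<theta>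
    by (simp add: scaleR_diff_right power2_eq_square mult.assoc)
  show ?thesis
    unfolding invariant_def velocity_field Let_def forward_eq unfolding velocity_def ..
qed

lemma invariant_velocity_unique:
  assumes adm: "admissible w W" and fp: "step w = w" and inv: "invariant (velocity g)"
    and g_bound: "\<And>x. norm (g x) \<le> \<gamma>"
    and g_lipschitz: "\<And>x y. norm (g x - g y) \<le> (2 * l / h) * norm (x - y)"
  shows "velocity g = w"
proof (rule fixed_point_unique[OF adm fp])
  show "norm (velocity g x) \<le> m + h * \<gamma>" for x
  proof -
    have "norm (velocity g x) \<le> norm (- (1 / (1 - \<beta>)) *\<^sub>R G x) + norm (h *\<^sub>R g x)"
      unfolding velocity_def by (rule norm_triangle_ineq)
    also have "\<dots> = norm (G x) / (1 - \<beta>) + h * norm (g x)" using beta h_pos by simp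
    also have "\<dots> \<le> m + h * \<gamma>"
      unfolding m_def using beta h_pos G_bound g_bound by (intro add_mono divide_right_mono mult_left_mono) auto
    finally show ?thesis .
  qed
  show "step (velocity g) = velocity g"
  proof (rule invariant_imp_fixed_point[OF inv])
    fix x y
    have "velocity g x - velocity g y = - (1 / (1 - \<beta>)) *\<^sub>R (G x - G y) + h *\<^sub>R (g x - g y)"
      by (simp add: velocity_def algebra_simps)
    also have "norm \<dots> \<le> norm (- (1 / (1 - \<beta>)) *\<^sub>R (G x - G y)) + norm (h *\<^sub>R (g x - g y))"
      by (rule norm_triangle_ineq)
    also have "\<dots> = norm (G x - G y) / (1 - \<beta>) + h * norm (g x - g y)" using beta h_pos by simp
    also have "\<dots> \<le> d2 * norm (x - y) / (1 - \<beta>) + h * ((2 * l / h) * norm (x - y))"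
      using beta h_pos G_lipschitz g_lipschitz by (intro add_mono divide_right_mono mult_left_mono) auto
    \<comment> \<open>\<open>d2 / (1 - \<beta>)\<close> is half of \<open>l\<close>, and the
      \<open>g\<close> part contributes \<open>2 * l\<close>.\<close>
    also have "\<dots> = (5/2 * l) * norm (x - y)" using h_pos by (simp add: l_def)
    finally show "norm (velocity g x - velocity g y) \<le> (5/2 * l) * norm (x - y)" .
  qed
qed

end

section \<open>Choice of constants and assembly of the result\<close>

lemma transpose_matrix_eq_if_selfadjoint:
  fixes A :: "real^'n \<Rightarrow> real^'n"
  assumes "\<And>u v. A u \<bullet> v = u \<bullet> A v"
  shows "transpose (matrix A) = matrix A"
proof -
  have "A (axis i 1) $ j = A (axis j 1) $ i" for i j
    using assms[of "axis i 1" "axis j 1"] by (simp add: inner_axis inner_axis')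
  then show ?thesis by (simp add: transpose_def matrix_def vec_eq_iff)
qed

theorem mainTheorem1:
  fixes \<beta> :: real
    and L :: "real^'n \<Rightarrow> real"
    and G :: "real^'n \<Rightarrow> real^'n"
    and H :: "real^'n \<Rightarrow> ((real^'n) \<Rightarrow>\<^sub>L (real^'n))"
    and T :: "real^'n \<Rightarrow> ((real^'n) \<Rightarrow>\<^sub>L ((real^'n) \<Rightarrow>\<^sub>L (real^'n)))"
    and D1 D2 D3 D4 :: real
  assumes beta: "0 < \<beta>" "\<beta> < 1"
    and grad: "\<And>\<theta>. (L has_derivative (\<lambda>u. G \<theta> \<bullet> u)) (at \<theta>)"
    and hess: "\<And>\<theta>. (G has_derivative blinfun_apply (H \<theta>)) (at \<theta>)"
    and third: "\<And>\<theta>. (H has_derivative blinfun_apply (T \<theta>)) (at \<theta>)"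
    and third_cont: "continuous_on UNIV T"
    and D1: "\<And>\<theta>. norm (G \<theta>) \<le> D1"
    and D2: "\<And>\<theta>. norm (H \<theta>) \<le> D2"
    and D3: "\<And>\<theta>. norm (T \<theta>) \<le> D3"
    and D4: "\<And>\<theta>1 \<theta>2. norm (T \<theta>1 - T \<theta>2) \<le> D4 * dist \<theta>1 \<theta>2"
  shows "\<exists>h0>0. \<forall>h. 0 < h \<and> h < h0 \<longrightarrow>
    (\<exists>\<gamma> \<delta> lam. \<gamma> > 0 \<and> \<delta> > 0 \<and> lam > 0 \<and>
      (let eqn = (\<lambda>g::real^'n \<Rightarrow> real^'n. \<forall>\<theta>.
             (let \<zeta> = \<theta> - (h / (1 - \<beta>)) *\<^sub>R G \<theta> + (h^2 * \<beta>) *\<^sub>R g \<theta> in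
              - (1 / (1 - \<beta>)) *\<^sub>R G \<zeta> + h *\<^sub>R g \<zeta>
                = - (1 / (1 - \<beta>)) *\<^sub>R G \<theta> + (h * \<beta>) *\<^sub>R g \<theta>))
       in \<exists>g. g \<in> Gamma \<gamma> \<delta> lam \<and> eqn g \<and>
            (\<forall>g'. g' \<in> Gamma \<gamma> \<delta> lam \<and> eqn g' \<longrightarrow> g' = g) \<and>
            (\<forall>\<theta>s vs. HB_seq \<beta> h G \<theta>s vs \<longrightarrow> (\<forall>n.
               norm (vs n + (1 / (1 - \<beta>)) *\<^sub>R G (\<theta>s n) - h *\<^sub>R g (\<theta>s n))
                 \<le> (\<beta> + h^2 * \<beta> * \<delta>) ^ n *
                   norm (vs 0 + (1 / (1 - \<beta>)) *\<^sub>R G (\<theta>s 0) - h *\<^sub>R g (\<theta>s 0))))))"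
proof -
  \<comment> \<open>Adding 1 makes the bounds strictly positive even if a derivative of
    \<open>L\<close> vanishes identically, so \<gamma>, \<delta> and \<open>lam\<close> come out
    positive.\<close>
  define d1 d2 d3 where "d1 = D1 + 1" and "d2 = D2 + 1" and "d3 = D3 + 1"
  have d_pos: "0 < d1" "0 < d2" "0 < d3"
    using norm_ge_zero[of "G 0"] D1[of 0] norm_ge_zero[of "H 0"] D2[of 0] norm_ge_zero[of "T 0"] D3[of 0]
    unfolding d1_def d2_def d3_def by linarith+
  have G_bound: "norm (G x) \<le> d1" and H_bound: "norm (H x) \<le> d2" for x
    using D1[of x] D2[of x] by (auto simp: d1_def d2_def)
  have H_lipschitz: "norm (H x - H y) \<le> d3 * norm (x - y)" for x y
    by (rule lipschitz_of_blinfun_derivative_bound[OF third]) (use D3 in \<open>auto simp: d3_def intro: add_increasing2\<close>)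
  have H_symmetric: "H x u \<bullet> v = u \<bullet> H x v" for x u v
    by (rule hessian_symmetric[OF grad hess H_lipschitz]) (use d_pos in auto)
  \<comment> \<open>Solved from the smallness condition of the locale:
    \<open>16 * h * d2 < (1 - \<beta>)\<^sup>2\<close>.\<close>
  define h0 where "h0 = (1 - \<beta>)\<^sup>2 / (16 * d2)"
  have "0 < h0" using beta d_pos by (simp add: h0_def)
  show ?thesis
  proof (rule exI[of _ h0], intro conjI allI impI \<open>0 < h0\<close>)
    fix h :: real assume h: "0 < h \<and> h < h0"
    interpret heavy_ball \<beta> h d1 d2 d3 G H
    proof
      have "h * (16 * d2) < (1 - \<beta>)\<^sup>2"
        using h d_pos by (simp add: h0_def pos_less_divide_eq)
      then show "h * (2 * d2 / (1 - \<beta>)) < (1 - \<beta>) / 8"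
        using beta by (simp add: field_simps power2_eq_square)
    qed (use beta h d_pos hess G_bound H_bound H_lipschitz H_symmetric in auto)
    obtain w W where adm: "admissible w W" and fp: "step w = w"
      by (rule fixed_point_exists)
    \<comment> \<open>\<open>\<delta>\<close> is of order \<open>1 / h\<close>: the rate \<open>\<beta> + h\<^sup>2 \<beta> \<delta>\<close> only covers the attraction estimate if
      \<open>h \<delta>\<close> dominates the Lipschitz constant \<open>l\<close> of \<open>w\<close>.\<close>
    define \<gamma> \<delta> lam where "\<gamma> = 2 * m / h" and "\<delta> = 2 * l / h" and "lam = 2 * \<Lambda> / h"
    define g where "g x = (1 / h) *\<^sub>R (w x + (1 / (1 - \<beta>)) *\<^sub>R G x)" for x
    define Dg where "Dg x = (1 / h) *\<^sub>R (W x + (1 / (1 - \<beta>)) *\<^sub>R H x)" for x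
    have velocity_g: "velocity g = w"
      using h_pos by (simp add: velocity_def g_def fun_eq_iff)
    have Dg_lipschitz: "norm (Dg x - Dg y) \<le> lam * dist x y" for x y
    proof -
      have "Dg x - Dg y = (1 / h) *\<^sub>R ((W x - W y) + (1 / (1 - \<beta>)) *\<^sub>R (H x - H y))"
        by (simp add: Dg_def algebra_simps)
      also have "norm \<dots> \<le> (\<Lambda> * norm (x - y) + d3 * norm (x - y) / (1 - \<beta>)) / h"
        by (rule norm_rescaled_sum_le[OF admissibleD(4)[OF adm] H_lipschitz])
      \<comment> \<open>\<open>d3 / (1 - \<beta>)\<close> is half of \<open>\<Lambda>\<close>; the
        derivative bound below likewise adds half of \<open>l\<close>.\<close>
      also have "\<dots> = (3/2 * (\<Lambda> * norm (x - y))) / h"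
        by (simp add: \<Lambda>_def)
      also have "\<dots> \<le> (2 * (\<Lambda> * norm (x - y))) / h"
        using h_pos \<Lambda>_pos by (intro divide_right_mono mult_right_mono) auto
      finally show ?thesis by (simp add: lam_def dist_norm)
    qed
    have g_deriv: "(g has_derivative blinfun_apply (Dg x)) (at x)" for x
      unfolding g_def[abs_def] Dg_def
      by (auto intro!: derivative_eq_intros admissibleD(1)[OF adm] hess
          simp: blinfun.add_left blinfun.scaleR_left)
    have g_Gamma: "g \<in> Gamma \<gamma> \<delta> lam"
      unfolding Gamma_def
    proof (intro CollectI exI[of _ Dg] conjI allI g_deriv Dg_lipschitz)
      show "continuous_on UNIV Dg"
        using Dg_lipschitz \<Lambda>_pos h_pos
        by (intro lipschitz_on_continuous_on[of lam] lipschitz_onI) (auto simp: dist_norm lam_def)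
      fix x
      show "norm (g x) \<le> \<gamma>"
        using norm_rescaled_sum_le[OF admissibleD(2)[OF adm] G_bound] by (simp add: g_def \<gamma>_def m_def)
      have "norm (Dg x) \<le> (l + d2 / (1 - \<beta>)) / h"
        unfolding Dg_def by (rule norm_rescaled_sum_le[OF admissibleD(3)[OF adm] H_bound])
      also have "\<dots> = (3/2 * l) / h" by (simp add: l_def)
      also have "\<dots> \<le> \<delta>" unfolding \<delta>_def using h_pos l_pos by (intro divide_right_mono mult_right_mono) auto
      finally show "norm (Dg x) \<le> \<delta>" .
      show "transpose (matrix (blinfun_apply (Dg x))) = matrix (blinfun_apply (Dg x))"
        by (rule transpose_matrix_eq_if_selfadjoint)
          (simp add: Dg_def blinfun.add_left blinfun.scaleR_left inner_add_left inner_add_right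
            fixed_point_symmetric[OF adm fp] H_symmetric)
    qed
    \<comment> \<open>Membership in \<open>Gamma\<close> yields the sup bound and, through the
      derivative bound, the Lipschitz constant \<open>2 * l / h\<close> that the uniqueness lemma
      asks of a competitor. \<open>velocity\<close> is injective as \<open>h\<close> is
      nonzero.\<close>
    have g_unique: "g' = g" if g': "g' \<in> Gamma \<gamma> \<delta> lam" and inv': "invariant (velocity g')" for g'
    proof -
      obtain Dg' where Dg': "\<And>x. (g' has_derivative blinfun_apply (Dg' x)) (at x)"
        "\<And>x. norm (g' x) \<le> \<gamma>" "\<And>x. norm (Dg' x) \<le> 2 * l / h"
        using g' unfolding Gamma_def \<delta>_def by blast
      have "velocity g' = velocity g"
        unfolding velocity_g
        by (rule invariant_velocity_unique[OF adm fp inv' Dg'(2)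
              lipschitz_of_blinfun_derivative_bound[OF Dg'(1) Dg'(3)]])
      then show ?thesis using h_pos by (simp add: velocity_def fun_eq_iff)
    qed
    have inv: "invariant w" by (rule fixed_point_imp_invariant[OF adm fp])
    have attraction: "norm (vs n - w (\<theta>s n)) \<le> (\<beta> + h\<^sup>2 * \<beta> * \<delta>) ^ n * norm (vs 0 - w (\<theta>s 0))"
      if hb: "HB_seq \<beta> h G \<theta>s vs" for \<theta>s vs n
    proof (induction n)
      case (Suc n)
      have rate: "h\<^sup>2 * \<beta> * \<delta> = 2 * (h * \<beta> * l)" using h_pos by (simp add: \<delta>_def power2_eq_square)
      have pos: "0 < h * \<beta> * l" using h_pos beta l_pos by simp
      have "norm (vs (Suc n) - w (\<theta>s (Suc n))) \<le> (\<beta> + h * \<beta> * l) * norm (vs n - w (\<theta>s n))"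
        using hb attraction_step[OF adm inv, of "vs n" "\<theta>s n"] by (simp add: HB_seq_def)
      also have "\<dots> \<le> (\<beta> + h\<^sup>2 * \<beta> * \<delta>) * ((\<beta> + h\<^sup>2 * \<beta> * \<delta>) ^ n * norm (vs 0 - w (\<theta>s 0)))"
      proof (rule mult_mono[OF _ Suc.IH])
        show "\<beta> + h * \<beta> * l \<le> \<beta> + h\<^sup>2 * \<beta> * \<delta>" "0 \<le> \<beta> + h\<^sup>2 * \<beta> * \<delta>"
          using rate pos beta by linarith+
      qed simp
      finally show ?case by (simp add: mult.assoc)
    qed simp
    \<comment> \<open>The quantity to be estimated is the distance of the velocity from the
      invariant graph.\<close>
    have w_eq: "v + (1 / (1 - \<beta>)) *\<^sub>R G x - h *\<^sub>R g x = v - w x" for v x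
      unfolding velocity_g[symmetric] velocity_def by simp
    have graph: "g \<in> Gamma \<gamma> \<delta> lam \<and> invariant (velocity g) \<and>
        (\<forall>g'. g' \<in> Gamma \<gamma> \<delta> lam \<and> invariant (velocity g') \<longrightarrow> g' = g) \<and>
        (\<forall>\<theta>s vs. HB_seq \<beta> h G \<theta>s vs \<longrightarrow> (\<forall>n.
           norm (vs n + (1 / (1 - \<beta>)) *\<^sub>R G (\<theta>s n) - h *\<^sub>R g (\<theta>s n))
             \<le> (\<beta> + h\<^sup>2 * \<beta> * \<delta>) ^ n *
               norm (vs 0 + (1 / (1 - \<beta>)) *\<^sub>R G (\<theta>s 0) - h *\<^sub>R g (\<theta>s 0))))"
      unfolding w_eq velocity_g using g_Gamma inv g_unique attraction by blast
    have pos: "0 < \<gamma>" "0 < \<delta>" "0 < lam" using m_pos l_pos \<Lambda>_pos h_pos by (auto simp: \<gamma>_def \<delta>_def lam_def)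
    show "\<exists>\<gamma> \<delta> lam. \<gamma> > 0 \<and> \<delta> > 0 \<and> lam > 0 \<and>
      (let eqn = (\<lambda>g::real^'n \<Rightarrow> real^'n. \<forall>\<theta>.
             (let \<zeta> = \<theta> - (h / (1 - \<beta>)) *\<^sub>R G \<theta> + (h^2 * \<beta>) *\<^sub>R g \<theta> in
              - (1 / (1 - \<beta>)) *\<^sub>R G \<zeta> + h *\<^sub>R g \<zeta>
                = - (1 / (1 - \<beta>)) *\<^sub>R G \<theta> + (h * \<beta>) *\<^sub>R g \<theta>))
       in \<exists>g. g \<in> Gamma \<gamma> \<delta> lam \<and> eqn g \<and>
            (\<forall>g'. g' \<in> Gamma \<gamma> \<delta> lam \<and> eqn g' \<longrightarrow> g' = g) \<and>
            (\<forall>\<theta>s vs. HB_seq \<beta> h G \<theta>s vs \<longrightarrow> (\<forall>n.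
               norm (vs n + (1 / (1 - \<beta>)) *\<^sub>R G (\<theta>s n) - h *\<^sub>R g (\<theta>s n))
                 \<le> (\<beta> + h^2 * \<beta> * \<delta>) ^ n *
                   norm (vs 0 + (1 / (1 - \<beta>)) *\<^sub>R G (\<theta>s 0) - h *\<^sub>R g (\<theta>s 0)))))"
      unfolding Let_def
      by (rule exI[of _ \<gamma>], rule exI[of _ \<delta>], rule exI[of _ lam], intro conjI pos, rule exI[of _ g], rule graph[unfolded invariant_velocity_iff Let_def])
  qed
qed

end
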